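(* Let $T$ be a tree with $n$ vertices and matching number $\beta$. Then $$SO_{1}(T)\leq \frac{1}{2}(n-\beta-1)(n-\beta)(n-\beta+1),$$ with equality if and only if $T\cong M_{n}^{\beta}$.
   Context: All graphs are finite and simple. For a graph $G$, $d_u$ is the degree of the vertex $u$, and $SO_{1}(G)=\frac{1}{2}\sum_{uv\in E(G)}|d_{u}^{2}-d_{v}^{2}|$. The matching number $\beta(G)$ is the number of edges in a maximum matching of $G$. $S_m$ denotes the star with $m$ vertices. $M_{n}^{\beta}$ is the tree on $n$ vertices obtained from the star $S_{n-\beta+1}$ by subdividing $\beta-1$ of its pendent edges (each once). *)

theory Defs
  imports Complex_Main "Graph_Theory.Graph_Theory"
begin

text \<open>
  A finite simple graph is a \<open>pair_graph\<close>, that is, a finite symmetric loop-free digraph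
  without parallel arcs: every undirected edge \<open>{u, v}\<close> is represented by the two arcs
  \<open>(u, v)\<close> and \<open>(v, u)\<close>.
\<close>

definition edges :: "'a pair_pre_digraph \<Rightarrow> 'a set set" where
  "edges G = {{u, v} | u v. (u, v) \<in> parcs G}"

text \<open>By symmetry the out-degree of a vertex is its degree in the undirected graph.\<close>

abbreviation degree :: "'a pair_pre_digraph \<Rightarrow> 'a \<Rightarrow> nat" where
  "degree G v \<equiv> out_degree (with_proj G) v"

text \<open>
  The library constant \<^const>\<open>tree\<close> excludes all directed cycles, including the closed walks
  \<open>u, v, u\<close> which every edge of a symmetric digraph gives rise to. An undirected cycle has at
  least three edges.
\<close>

definition undirected_tree :: "'a pair_pre_digraph \<Rightarrow> bool" where
  "undirected_tree G \<longleftrightarrow>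
     pair_graph G \<and> connected (with_proj G) \<and>
     \<not> (\<exists>p. pre_digraph.cycle (with_proj G) p \<and> length p \<ge> 3)"

text \<open>
  The value below is uniquely determined, since \<open>\<bar>d_u\<^sup>2 - d_v\<^sup>2\<bar>\<close> does not depend on the
  order in which the end vertices of the edge are taken.
\<close>

definition edge_weight :: "'a pair_pre_digraph \<Rightarrow> 'a set \<Rightarrow> real" where
  "edge_weight G e =
     (THE x. \<exists>u v. e = {u, v} \<and> x = \<bar>real (degree G u) ^ 2 - real (degree G v) ^ 2\<bar>)"

lemma edge_weight_insert:
  "edge_weight G {u, v} = \<bar>real (degree G u) ^ 2 - real (degree G v) ^ 2\<bar>"
  unfolding edge_weight_def
  by (rule the_equality) (auto simp: doubleton_eq_iff abs_minus_commute)

definition SO1 :: "'a pair_pre_digraph \<Rightarrow> real" where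
  "SO1 G = 1 / 2 * (\<Sum>e\<in>edges G. edge_weight G e)"

definition matching :: "'a pair_pre_digraph \<Rightarrow> 'a set set \<Rightarrow> bool" where
  "matching G M \<longleftrightarrow> M \<subseteq> edges G \<and> (\<forall>e\<in>M. \<forall>f\<in>M. e \<noteq> f \<longrightarrow> e \<inter> f = {})"

definition matching_number :: "'a pair_pre_digraph \<Rightarrow> nat" where
  "matching_number G = Max {card M | M. matching G M}"

text \<open>The star with \<open>m\<close> vertices \<open>0, \<dots>, m - 1\<close>, of which \<open>0\<close> is the centre.\<close>

definition star :: "nat \<Rightarrow> nat pair_pre_digraph" where
  "star m = \<lparr> pverts = {..<m},
              parcs = {(u, v). u < m \<and> v < m \<and> (u = 0 \<longleftrightarrow> v \<noteq> 0)} \<rparr>"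

text \<open>
  \<open>subdivided_star m k\<close> arises from \<open>star m\<close> by subdividing the pendent edges
  \<open>{0, 1}, \<dots>, {0, k}\<close>, the new vertices being \<open>m, \<dots>, m + k - 1\<close>; this is meaningful
  for \<open>k < m\<close>.
\<close>

primrec subdivided_star :: "nat \<Rightarrow> nat \<Rightarrow> nat pair_pre_digraph" where
  "subdivided_star m 0 = star m"
| "subdivided_star m (Suc k) = subdivide (subdivided_star m k) (0, Suc k) (m + k)"

text \<open>
  Meaningful for \<open>1 \<le> \<beta>\<close> and \<open>2 * \<beta> \<le> n\<close>; these hold whenever \<open>\<beta>\<close> is the matching number
  of a graph with \<open>n\<close> vertices and at least one edge.
\<close>

definition M_tree :: "nat \<Rightarrow> nat \<Rightarrow> nat pair_pre_digraph" where
  "M_tree n \<beta> = subdivided_star (n - \<beta> + 1) (\<beta> - 1)"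

end

(*
  Let M be a matching of a forest on n vertices and D = n - |M|. The neighbours of a vertex are
  pairwise non-adjacent, so every edge of M contains a non-neighbour of it; hence all degrees are
  at most D. A forest with a vertex of degree at least 2 contains a non-leaf w with at most one
  non-leaf neighbour. Delete a leaf at w if there are two of them, and otherwise delete w together
  with its only leaf. This lowers D, and it lowers the sum of |d_u^2 - d_v^2| over the edges by at
  most 3 d (d - 1), where d <= D is the degree of the remaining vertex that loses a neighbour.
  Since f(D) - f(D - 1) = 3 D (D - 1) for f(D) = (D - 1) D (D + 1), induction gives the bound,
  and equality forces d = D. A vertex of degree D determines the forest when M is nonempty: each
  edge of M contains exactly one non-neighbour of it, and the absence of cycles of length 3, 4
  and 5 excludes all further edges.
*)

theory Submission
  imports Defs
begin

section \<open>Neighbourhoods, degrees and the sum over arcs\<close>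

abbreviation nbrs :: "'a pair_pre_digraph \<Rightarrow> 'a \<Rightarrow> 'a set" where
  "nbrs G v \<equiv> parcs G `` {v}"

lemma degree_conv_card_nbrs: "degree G v = card (nbrs G v)"
proof -
  have "nbrs G v = snd ` out_arcs (with_proj G) v"
    by force
  moreover have "inj_on snd (out_arcs (with_proj G) v)"
    by (auto intro!: inj_onI)
  ultimately show ?thesis
    by (simp add: out_degree_def card_image)
qed

lemma pair_graph_facts:
  assumes "pair_graph G"
  shows "finite (pverts G)" and "finite (parcs G)" and "pair_fin_digraph G"
    and "(u, v) \<in> parcs G \<Longrightarrow> (v, u) \<in> parcs G"
    and "(u, v) \<in> parcs G \<Longrightarrow> u \<noteq> v"
    and "(u, v) \<in> parcs G \<Longrightarrow> u \<in> pverts G"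
    and "(u, v) \<in> parcs G \<Longrightarrow> v \<in> pverts G"
proof -
  interpret pair_graph G by fact
  show "finite (pverts G)" "finite (parcs G)" "pair_fin_digraph G"
    using pair_finite_verts pair_finite_arcs by (auto intro: pair_fin_digraph_axioms)
  show "(u, v) \<in> parcs G \<Longrightarrow> (v, u) \<in> parcs G" by (rule arcs_symmetric)
  show "(u, v) \<in> parcs G \<Longrightarrow> u \<noteq> v" using pair_no_loops by fastforce
  show "(u, v) \<in> parcs G \<Longrightarrow> u \<in> pverts G" using arc_fst_in_verts by fastforce
  show "(u, v) \<in> parcs G \<Longrightarrow> v \<in> pverts G" using arc_snd_in_verts by fastforce
qed

lemma finite_nbrs: "pair_graph G \<Longrightarrow> finite (nbrs G v)"
  by (simp add: pair_graph_facts(2) finite_Image)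

lemma pair_graphI:
  assumes "finite (pverts G)" "finite (parcs G)"
    and "\<And>u v. (u, v) \<in> parcs G \<Longrightarrow> u \<in> pverts G \<and> u \<noteq> v \<and> (v, u) \<in> parcs G"
  shows "pair_graph G"
proof unfold_locales
  show "symmetric (with_proj G)"
    using assms(3) by (auto simp: symmetric_def intro!: symI)
  fix e assume "e \<in> parcs G"
  then have e: "(fst e, snd e) \<in> parcs G" by simp
  show "fst e \<in> pverts G" "snd e \<in> pverts G" "fst e \<noteq> snd e"
    using assms(3)[OF e] assms(3)[of "snd e" "fst e"] by blast+
qed fact+

lemma degree_pos_iff:
  assumes "pair_graph G"
  shows "degree G u \<ge> 1 \<longleftrightarrow> (\<exists>v. (u, v) \<in> parcs G)"
  using finite_nbrs[OF assms, of u]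
  by (auto simp: degree_conv_card_nbrs Suc_le_eq card_gt_0_iff)

text \<open>Every edge enters through both of its arcs and the factor 1/2 is left out, so the value
  is four times \<open>SO1\<close>. Summing over arcs avoids the definite description in
  \<open>edge_weight\<close>.\<close>

definition arc_sum :: "'a pair_pre_digraph \<Rightarrow> real" where
  "arc_sum G = (\<Sum>(u, v)\<in>parcs G. \<bar>real (degree G u) ^ 2 - real (degree G v) ^ 2\<bar>)"

lemma SO1_conv_arc_sum:
  assumes "pair_graph G"
  shows "SO1 G = arc_sum G / 4"
proof -
  let ?w = "\<lambda>(u, v). \<bar>real (degree G u) ^ 2 - real (degree G v) ^ 2\<bar>"
  let ?e = "\<lambda>(u, v). {u, v}"
  note G = pair_graph_facts[OF assms]
  have "arc_sum G = (\<Sum>e\<in>?e ` parcs G. \<Sum>a\<in>{a \<in> parcs G. ?e a = e}. ?w a)"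
    unfolding arc_sum_def using G(2) by (rule sum.image_gen)
  also have "?e ` parcs G = edges G"
    by (auto simp: edges_def image_def)
  also have "(\<Sum>e\<in>edges G. \<Sum>a\<in>{a \<in> parcs G. ?e a = e}. ?w a) = (\<Sum>e\<in>edges G. 2 * edge_weight G e)"
  proof (rule sum.cong[OF refl])
    fix e assume e_edge: "e \<in> edges G"
    obtain u v where e: "e = {u, v}" and uv: "(u, v) \<in> parcs G"
      using e_edge by (auto simp: edges_def)
    \<comment> \<open>The two arcs over an edge are distinct because there are no loops; this gives
      the factor 2.\<close>
    have "{a \<in> parcs G. ?e a = e} = {(u, v), (v, u)}"
      using uv G(4) by (auto simp: e doubleton_eq_iff)
    then show "(\<Sum>a\<in>{a \<in> parcs G. ?e a = e}. ?w a) = 2 * edge_weight G e"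
      using G(5)[OF uv] by (simp add: e edge_weight_insert abs_minus_commute)
  qed
  finally show ?thesis
    by (simp add: SO1_def flip: sum_distrib_left)
qed

section \<open>Trees as 1-degenerate graphs\<close>

text \<open>
  Forests are described as the 1-degenerate graphs: this property passes to subgraphs and yields
  leaves, without any reasoning about walks.
\<close>

definition undirected_forest :: "'a pair_pre_digraph \<Rightarrow> bool" where
  "undirected_forest G \<longleftrightarrow> pair_graph G \<and>
     (\<forall>S\<subseteq>pverts G. S \<noteq> {} \<longrightarrow> (\<exists>x\<in>S. card (nbrs G x \<inter> S) \<le> 1))"

text \<open>Bridge between two views of walks: paths are easily extended and cut as vertex lists,
  whereas \<open>cycle\<close> speaks of arc lists.\<close>

lemma awalk_vwalk_arcs:
  assumes "pair_wf_digraph G" "u \<in> pverts G" "set (vwalk_arcs (u # p)) \<subseteq> parcs G"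
  shows "pre_digraph.awalk (with_proj G) u (vwalk_arcs (u # p)) (last (u # p))
    \<and> pre_digraph.awalk_verts (with_proj G) u (vwalk_arcs (u # p)) = u # p"
  using assms(2,3)
proof (induction p arbitrary: u)
  case Nil
  then show ?case
    by (simp add: pre_digraph.awalk_def cas_with_proj_eq awalk_verts_with_proj_eq)
next
  case (Cons v p)
  then have "v \<in> pverts G"
    using pair_wf_digraph.arc_snd_in_verts[OF assms(1)] by fastforce
  with Cons show ?case
    by (auto simp add: pre_digraph.awalk_def cas_with_proj_eq awalk_verts_with_proj_eq)
qed

text \<open>If every vertex of some nonempty \<open>S\<close> had two neighbours in
  \<open>S\<close>, a longest path in \<open>S\<close> could not be extended beyond its first
  vertex, so all neighbours of that vertex in \<open>S\<close> would lie on the path, and one of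
  them would close a cycle.\<close>

lemma undirected_tree_imp_forest:
  assumes "undirected_tree G"
  shows "undirected_forest G"
proof -
  have G: "pair_graph G" using assms by (simp add: undirected_tree_def)
  note F = pair_graph_facts[OF G]
  have wf: "pair_wf_digraph G" using F(3) by (rule pair_fin_digraph.axioms)
  have "\<exists>x\<in>S. card (nbrs G x \<inter> S) \<le> 1" if S: "S \<subseteq> pverts G" "S \<noteq> {}" for S
  proof (rule ccontr)
    assume "\<not> ?thesis"
    then have two: "card (nbrs G x \<inter> S) \<ge> 2" if "x \<in> S" for x
      using that by force
    have fS: "finite S" using S F(1) finite_subset by blast
    \<comment> \<open>Paths inside \<open>S\<close>, given by their vertices. Distinctness bounds
      their length by \<open>card S\<close>, so a longest one exists.\<close>
    let ?P = "\<lambda>p. p \<noteq> [] \<and> distinct p \<and> set p \<subseteq> S \<and> set (vwalk_arcs p) \<subseteq> parcs G"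
    obtain s where s: "s \<in> S" using S by blast
    have "?P [s]" using s by simp
    moreover have "\<forall>p. ?P p \<longrightarrow> length p < Suc (card S)"
      by (metis card_mono distinct_card fS le_imp_less_Suc)
    ultimately obtain p where p: "?P p" and max: "\<And>q. ?P q \<Longrightarrow> length q \<le> length p"
      using ex_has_greatest_nat[of ?P "[s]" length "Suc (card S)"] by (metis (no_types, lifting))
    \<comment> \<open>a second neighbour of an end of a longest path closes a cycle\<close>
    obtain x ys where x: "p = x # ys" using p by (cases p) auto
    \<comment> \<open>If \<open>ys\<close> is empty, \<open>hd ys\<close> is an unspecified value.
      Since two neighbours are available, any single value can be avoided, so this case needs no
      separate treatment.\<close>
    have "\<exists>y\<in>nbrs G x \<inter> S. y \<noteq> hd ys"
    proof (rule ccontr)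
      assume "\<not> ?thesis"
      then have "nbrs G x \<inter> S \<subseteq> {hd ys}" by blast
      then have "card (nbrs G x \<inter> S) \<le> 1"
        by (metis card_mono card_1_singleton_iff finite.emptyI finite.insertI One_nat_def)
      with two[of x] p x show False by simp
    qed
    then obtain y where y: "(x, y) \<in> parcs G" "y \<in> S" "y \<noteq> hd ys" by blast
    have "y \<in> set p"
    proof (rule ccontr)
      assume "y \<notin> set p"
      then have "?P (y # p)" using p x y F(4) by auto
      then show False using max by fastforce
    qed
    then have "y \<in> set ys" using x F(5)[OF y(1)] by simp
    then obtain as bs where ys: "ys = as @ y # bs" by (meson split_list)
    \<comment> \<open>A nonempty \<open>as\<close> gives the closed walk at least three arcs, so it
      is not an edge traversed back and forth.\<close>
    have as: "as \<noteq> []" using ys y(3) by auto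
    let ?q = "x # as @ [y]"
    have pq: "p = ?q @ bs" using x ys by simp
    have "set (vwalk_arcs ?q) \<subseteq> parcs G"
      using p set_vwalk_arcs_append1[of ?q bs] pq by auto
    then have arcs: "set (vwalk_arcs (y # ?q)) \<subseteq> parcs G"
      using F(4)[OF y(1)] by simp
    have "distinct ?q" using p pq by auto
    then have "pre_digraph.cycle (with_proj G) (vwalk_arcs (y # ?q))"
      using awalk_vwalk_arcs[OF wf _ arcs] F(7)[OF y(1)]
      unfolding pre_digraph.cycle_def by (intro exI[of _ y]) auto
    moreover have "length (vwalk_arcs (y # ?q)) \<ge> 3"
      using vwalk_length_simp[of "y # ?q"] as unfolding vwalk_length_def
      by (cases as) auto
    ultimately show False using assms by (auto simp: undirected_tree_def)
  qed
  then show ?thesis using G by (simp add: undirected_forest_def)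
qed

text \<open>Serves to exclude short cycles: the vertex set of a cycle satisfies the last hypothesis
  and would have to be empty.\<close>

lemma undirected_forest_no_two_nbrs:
  assumes "undirected_forest G" "S \<subseteq> pverts G"
    and "\<And>x. x \<in> S \<Longrightarrow> \<exists>a b. a \<noteq> b \<and> a \<in> S \<and> b \<in> S \<and> (x, a) \<in> parcs G \<and> (x, b) \<in> parcs G"
  shows "S = {}"
proof (rule ccontr)
  assume "S \<noteq> {}"
  then obtain x where x: "x \<in> S" "card (nbrs G x \<inter> S) \<le> 1"
    using assms(1,2) unfolding undirected_forest_def by blast
  obtain a b where ab: "a \<noteq> b" "{a, b} \<subseteq> nbrs G x \<inter> S"
    using assms(3)[OF x(1)] by blast
  have "finite (nbrs G x \<inter> S)"
    using assms(1) by (simp add: undirected_forest_def finite_nbrs)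
  then have "card {a, b} \<le> 1" using card_mono[OF _ ab(2)] x(2) by linarith
  then show False using ab(1) by simp
qed

lemma undirected_forest_subgraph:
  assumes "undirected_forest G" "pair_graph H" "pverts H \<subseteq> pverts G" "parcs H \<subseteq> parcs G"
  shows "undirected_forest H"
  unfolding undirected_forest_def
proof (intro conjI allI impI)
  fix S assume S: "S \<subseteq> pverts H" "S \<noteq> {}"
  then obtain x where x: "x \<in> S" "card (nbrs G x \<inter> S) \<le> 1"
    using assms(1,3) unfolding undirected_forest_def by (meson order_trans)
  have "finite (nbrs G x \<inter> S)"
    using assms(1) by (simp add: undirected_forest_def finite_nbrs)
  then have "card (nbrs H x \<inter> S) \<le> card (nbrs G x \<inter> S)"
    using assms(4) by (intro card_mono) auto
  then show "\<exists>x\<in>S. card (nbrs H x \<inter> S) \<le> 1" using x by force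
qed fact

section \<open>Change of the arc sum when one vertex loses a neighbour\<close>

text \<open>On arcs of \<open>H\<close> only the square at \<open>x\<close> changes, by d^2 -
  (d-1)^2 = 2d - 1. In \<open>H\<close> there are d - 1 arcs leaving \<open>x\<close> and d - 1 arcs
  entering it, and by the triangle inequality the weight of each grows by at most 2d - 1.\<close>

lemma arc_sum_peel_le:
  assumes "pair_graph H"
    and x: "degree G x = degree H x + 1"
    and others: "\<And>u v. (u, v) \<in> parcs H \<Longrightarrow> u \<noteq> x \<Longrightarrow> degree G u = degree H u"
  defines "d \<equiv> real (degree G x)"
  shows "(\<Sum>(u, v)\<in>parcs H. \<bar>real (degree G u) ^ 2 - real (degree G v) ^ 2\<bar>)
    \<le> arc_sum H + 2 * (d - 1) * (2 * d - 1)"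
proof -
  note H = pair_graph_facts[OF assms(1)]
  have out: "(\<Sum>(u, v)\<in>parcs H. of_bool (u = x)) = d - 1"
  proof -
    have "(\<Sum>(u, v)\<in>parcs H. of_bool (u = x) :: real) = real (card (out_arcs (with_proj H) x))"
      using H(2) by (simp add: case_prod_beta out_arcs_def of_bool_def sum.If_cases Int_def)
    then show ?thesis using x by (simp add: out_degree_def d_def)
  qed
  have "(\<Sum>(u, v)\<in>parcs H. of_bool (v = x)) = (\<Sum>(u, v)\<in>parcs H. of_bool (u = x) :: real)"
    by (rule sum.reindex_bij_witness[of _ prod.swap prod.swap]) (use H(4) in auto)
  then have "in": "(\<Sum>(u, v)\<in>parcs H. of_bool (v = x)) = d - 1"
    using out by simp
  have le: "\<bar>real (degree G u) ^ 2 - real (degree G v) ^ 2\<bar>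
      \<le> \<bar>real (degree H u) ^ 2 - real (degree H v) ^ 2\<bar>
        + (2 * d - 1) * of_bool (u = x) + (2 * d - 1) * of_bool (v = x)"
    if uv: "(u, v) \<in> parcs H" for u v
  proof -
    have "real (degree G y) ^ 2 = real (degree H y) ^ 2 + (2 * d - 1) * of_bool (y = x)"
      if "(y, z) \<in> parcs H" for y z
    proof (cases "y = x")
      case True
      then show ?thesis using x by (simp add: d_def power2_eq_square algebra_simps)
    qed (use others[OF that] in simp)
    note this[OF uv] this[OF H(4)[OF uv]]
    moreover have "(2 * d - 1) * of_bool (y = x) \<ge> 0" for y
      using x by (simp add: d_def)
    from this[of u] this[of v]
    show ?thesis unfolding calculation by linarith
  qed
  have "(\<Sum>(u, v)\<in>parcs H. \<bar>real (degree G u) ^ 2 - real (degree G v) ^ 2\<bar>)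
    \<le> (\<Sum>(u, v)\<in>parcs H. \<bar>real (degree H u) ^ 2 - real (degree H v) ^ 2\<bar>
        + (2 * d - 1) * of_bool (u = x) + (2 * d - 1) * of_bool (v = x))"
    using le by (intro sum_mono) auto
  also have "\<dots> = arc_sum H + (2 * d - 1) * (d - 1) + (2 * d - 1) * (d - 1)"
    unfolding arc_sum_def case_prod_beta sum.distrib sum_distrib_left[symmetric]
    using out "in" by (simp add: case_prod_beta)
  finally show ?thesis by (simp add: algebra_simps)
qed

text \<open>The forest property is applied to the set of vertices of degree at least 2, which
  contains \<open>u\<close>. The vertex obtained plays the role of the last but one vertex of a
  longest path.\<close>

lemma undirected_forest_ex_penultimate:
  assumes "undirected_forest G" "degree G u \<ge> 2"
  obtains w where "w \<in> pverts G" "degree G w \<ge> 2" "card {y \<in> nbrs G w. degree G y \<ge> 2} \<le> 1"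
proof -
  have G: "pair_graph G" using assms(1) by (simp add: undirected_forest_def)
  let ?S = "{y \<in> pverts G. degree G y \<ge> 2}"
  obtain v where "(u, v) \<in> parcs G" using degree_pos_iff[OF G, of u] assms(2) by auto
  then have "u \<in> ?S" using assms(2) pair_graph_facts(6)[OF G] by simp
  then have "?S \<subseteq> pverts G" "?S \<noteq> {}" by auto
  then obtain w where w: "w \<in> ?S" "card (nbrs G w \<inter> ?S) \<le> 1"
    using assms(1) unfolding undirected_forest_def by meson
  have "nbrs G w \<inter> ?S = {y \<in> nbrs G w. degree G y \<ge> 2}"
    using pair_graph_facts(7)[OF G] by auto
  then show ?thesis using w by (intro that[of w]) auto
qed

section \<open>Leaves and matching edges\<close>

lemma nbrs_leaf:
  assumes "pair_graph G" "(w, v) \<in> parcs G" "degree G v < 2"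
  shows "nbrs G v = {w}"
proof -
  have "w \<in> nbrs G v" using pair_graph_facts(4)[OF assms(1,2)] by simp
  moreover have "card (nbrs G v) \<le> 1" using assms(3) by (simp add: degree_conv_card_nbrs)
  ultimately show ?thesis
    using finite_nbrs[OF assms(1), of v] by (metis card_le_Suc0_iff_eq One_nat_def equals0D
        is_singletonI' is_singletonE singletonD)
qed

lemma finite_edges:
  assumes "pair_graph G"
  shows "finite (edges G)"
proof -
  have "edges G = (\<lambda>(u, v). {u, v}) ` parcs G" by (auto simp: edges_def image_def)
  then show ?thesis using pair_graph_facts(2)[OF assms] by simp
qed

lemma matching_finite:
  assumes "pair_graph G" "matching G M"
  shows "finite M"
  using assms finite_edges by (auto simp: matching_def intro: finite_subset)

lemma matching_eqI:
  assumes "matching G M" "e \<in> M" "f \<in> M" "x \<in> e" "x \<in> f"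
  shows "e = f"
  using assms unfolding matching_def by (metis disjoint_iff)

lemma edge_leaf:
  assumes "e \<in> edges G" "pair_graph G" "nbrs G v = {w}" "v \<in> e"
  shows "e = {w, v}"
proof -
  obtain a b where ab: "e = {a, b}" "(a, b) \<in> parcs G" using assms(1) by (auto simp: edges_def)
  then have "(b, a) \<in> parcs G" using pair_graph_facts(4)[OF assms(2)] by blast
  then show ?thesis using ab assms(3,4) by (cases "v = a") auto
qed

section \<open>Deletion of vertices and the two reductions\<close>

definition delete_verts :: "'a set \<Rightarrow> 'a pair_pre_digraph \<Rightarrow> 'a pair_pre_digraph" where
  "delete_verts W G =
    \<lparr>pverts = pverts G - W, parcs = {(u, v). (u, v) \<in> parcs G \<and> u \<notin> W \<and> v \<notin> W}\<rparr>"

lemma delete_verts_simps [simp]: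
  "pverts (delete_verts W G) = pverts G - W"
  "(u, v) \<in> parcs (delete_verts W G) \<longleftrightarrow> (u, v) \<in> parcs G \<and> u \<notin> W \<and> v \<notin> W"
  by (simp_all add: delete_verts_def)

lemma parcs_delete_verts_subset: "parcs (delete_verts W G) \<subseteq> parcs G"
  by auto

lemma nbrs_delete_verts: "u \<notin> W \<Longrightarrow> nbrs (delete_verts W G) u = nbrs G u - W"
  by auto

lemma edges_delete_verts: "edges (delete_verts W G) = {e \<in> edges G. e \<inter> W = {}}"
  by (auto simp: edges_def)

lemma pair_graph_delete_verts:
  assumes "pair_graph G"
  shows "pair_graph (delete_verts W G)"
proof (rule pair_graphI)
  show "finite (parcs (delete_verts W G))"
    using parcs_delete_verts_subset pair_graph_facts(2)[OF assms] by (rule finite_subset)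
  show "u \<in> pverts (delete_verts W G) \<and> u \<noteq> v \<and> (v, u) \<in> parcs (delete_verts W G)"
    if "(u, v) \<in> parcs (delete_verts W G)" for u v
    using that pair_graph_facts(4-6)[OF assms, of u v] by simp
qed (simp add: pair_graph_facts(1)[OF assms])

lemma undirected_forest_delete_verts:
  assumes "undirected_forest G"
  shows "undirected_forest (delete_verts W G)"
  using assms pair_graph_delete_verts parcs_delete_verts_subset
  by (intro undirected_forest_subgraph[OF assms]) (auto simp: undirected_forest_def)

text \<open>Deleting \<open>v\<close> costs one vertex and no matching edge, since
  \<open>{w, v'}\<close> can replace \<open>{w, v}\<close>. With d the degree of \<open>w\<close>,
  the lost edge accounts for 2(d^2 - 1) and the remaining edges at \<open>w\<close> for at most
  2(d-1)(2d-1), together 6d(d-1). The drop of vertices minus matching edges is written additively to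
  avoid truncated subtraction.\<close>

lemma forest_remove_leaf:
  fixes G :: "'a pair_pre_digraph"
  assumes "undirected_forest G" "matching G M"
    and vw: "(w, v) \<in> parcs G" "(w, v') \<in> parcs G" "v \<noteq> v'"
    and nv: "nbrs G v = {w}" and nv': "nbrs G v' = {w}"
  shows "\<exists>(H :: 'a pair_pre_digraph) M'. undirected_forest H \<and> matching H M' \<and> card (parcs H) < card (parcs G)
    \<and> card (pverts H) + card M + 1 \<le> card (pverts G) + card M'
    \<and> arc_sum G \<le> arc_sum H + 6 * real (degree G w) * (real (degree G w) - 1)"
proof -
  have G: "pair_graph G" using assms(1) by (simp add: undirected_forest_def)
  note F = pair_graph_facts[OF G]
  define H where "H = delete_verts {v} G"
  have H: "pair_graph H" unfolding H_def using G by (rule pair_graph_delete_verts)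
  have fH: "undirected_forest H"
    unfolding H_def using assms(1) by (rule undirected_forest_delete_verts)
  have wv: "w \<noteq> v" "w \<noteq> v'" "v \<in> pverts G" using F(5,7) vw by auto
  have vH: "card (pverts G) = card (pverts H) + 1"
    using F(1) wv(3) card.remove[of "pverts G" v] by (simp add: H_def)
  have wv_notin: "(w, v) \<notin> parcs H" "(v, w) \<notin> parcs H" by (simp_all add: H_def)
  have G_H: "parcs G = insert (w, v) (insert (v, w) (parcs H))"
  proof -
    have "b = w" if "(v, b) \<in> parcs G" for b using that nv by auto
    moreover have "a = w" if "(a, v) \<in> parcs G" for a using F(4)[OF that] nv by auto
    ultimately have "parcs G \<subseteq> insert (w, v) (insert (v, w) (parcs H))"
      by (auto simp: H_def)
    moreover have "insert (w, v) (insert (v, w) (parcs H)) \<subseteq> parcs G"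
      using vw(1) F(4)[OF vw(1)] parcs_delete_verts_subset[of "{v}" G] by (simp add: H_def)
    ultimately show ?thesis by (rule subset_antisym)
  qed
  have finH: "finite (parcs H)" using pair_graph_facts(2)[OF H] .
  have cH: "card (parcs H) < card (parcs G)"
    unfolding G_H using finH wv_notin wv by simp
  \<comment> \<open>If \<open>{w, v}\<close> is a matching edge, then the leaf \<open>v'\<close> is
    unmatched, because its only edge also contains \<open>w\<close>.\<close>
  define M' where "M' = (if {w, v} \<in> M then insert {w, v'} (M - {{w, v}}) else M)"
  note fM = matching_finite[OF G assms(2)]
  have Me: "e \<in> edges H" if "e \<in> M" "e \<noteq> {w, v}" for e
  proof -
    have "e \<in> edges G" using that assms(2) by (auto simp: matching_def)
    then show ?thesis
      using edge_leaf[OF _ G nv] that(2) by (auto simp: edges_delete_verts H_def)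
  qed
  have M': "matching H M' \<and> card M' = card M"
  proof (cases "{w, v} \<in> M")
    case True
    have w: "w \<notin> e" if "e \<in> M - {{w, v}}" for e
      using that True matching_eqI[OF assms(2), of e "{w, v}" w] by auto
    have v': "v' \<notin> e" if "e \<in> M - {{w, v}}" for e
      using edge_leaf[OF _ G nv', of e] w[OF that] that assms(2) by (auto simp: matching_def)
    have "(w, v') \<in> parcs H" using vw wv by (simp add: H_def)
    then have "{w, v'} \<in> edges H" by (auto simp: edges_def)
    then have "matching H M'"
      using True Me w v' assms(2) unfolding M'_def matching_def by auto
    moreover have "{w, v'} \<notin> M - {{w, v}}" using w by blast
    then have "card M' = Suc (card (M - {{w, v}}))"
      using True fM by (simp add: M'_def)
    then have "card M' = card M"
      using card.remove[OF fM True] by linarith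
    ultimately show ?thesis by blast
  next
    case False
    then have "M' = M" by (simp add: M'_def)
    moreover have "M \<subseteq> edges H" using Me False by blast
    ultimately show ?thesis using assms(2) by (simp add: matching_def)
  qed
  define d where "d = real (degree G w)"
  have nw: "nbrs H w = nbrs G w - {v}" unfolding H_def using wv by (intro nbrs_delete_verts) simp
  have dw: "degree G w = degree H w + 1"
    unfolding degree_conv_card_nbrs nw
    using card.remove[OF finite_nbrs[OF G, of w], of v] vw(1) by simp
  have dv: "degree G v = 1" unfolding degree_conv_card_nbrs nv by simp
  have others: "degree G a = degree H a" if ab: "(a, b) \<in> parcs H" "a \<noteq> w" for a b
  proof -
    have "v \<notin> nbrs G a" using F(4)[of a v] ab(2) nv by auto
    moreover have "nbrs H a = nbrs G a - {v}"
      unfolding H_def using ab(1) by (intro nbrs_delete_verts) (simp add: H_def)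
    ultimately show ?thesis by (simp add: degree_conv_card_nbrs)
  qed
  let ?w = "\<lambda>(u, v). \<bar>real (degree G u) ^ 2 - real (degree G v) ^ 2\<bar>"
  have "arc_sum G = sum ?w (insert (w, v) (insert (v, w) (parcs H)))"
    unfolding arc_sum_def G_H[symmetric] ..
  also have "\<dots> = sum ?w (parcs H) + 2 * (d ^ 2 - 1)"
    using finH wv wv_notin dw by (simp add: dv d_def)
  also have "\<dots> \<le> arc_sum H + 2 * (d - 1) * (2 * d - 1) + 2 * (d ^ 2 - 1)"
    using arc_sum_peel_le[OF H dw others] by (simp add: d_def)
  finally have "arc_sum G \<le> arc_sum H + 6 * d * (d - 1)"
    by (simp add: algebra_simps power2_eq_square)
  moreover have "card (pverts H) + card M + 1 \<le> card (pverts G) + card M'"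
    using vH M' by linarith
  ultimately show ?thesis using fH cH M' unfolding d_def by blast
qed

text \<open>Two vertices disappear, but at most one matching edge: an edge at \<open>v\<close> also
  contains \<open>w\<close>, and only one matching edge can contain \<open>w\<close>. With d the
  degree of \<open>u\<close>, the lost edges account for 6 and 2(d^2 - 4), the remaining edges at
  \<open>u\<close> for at most 2(d-1)(2d-1); the total is again 6d(d-1).\<close>

lemma forest_remove_pendant_path:
  fixes G :: "'a pair_pre_digraph"
  assumes "undirected_forest G" "matching G M"
    and nv: "nbrs G v = {w}" and nw: "nbrs G w = {v, u}" and "u \<noteq> v" and du: "degree G u \<ge> 2"
  shows "\<exists>(H :: 'a pair_pre_digraph) M'. undirected_forest H \<and> matching H M' \<and> card (parcs H) < card (parcs G)
    \<and> card (pverts H) + card M + 1 \<le> card (pverts G) + card M'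
    \<and> arc_sum G \<le> arc_sum H + 6 * real (degree G u) * (real (degree G u) - 1)"
proof -
  have G: "pair_graph G" using assms(1) by (simp add: undirected_forest_def)
  note F = pair_graph_facts[OF G]
  have vw: "(w, v) \<in> parcs G" "(w, u) \<in> parcs G" using nw by auto
  have wv: "(v, w) \<in> parcs G" "(u, w) \<in> parcs G" using F(4) vw by blast+
  have ne: "w \<noteq> v" "w \<noteq> u" "v \<in> pverts G" "w \<in> pverts G" using F(5-7) vw by auto
  \<comment> \<open>The arcs of the two edges that disappear.\<close>
  define R where "R = {(w, v), (v, w), (w, u), (u, w)}"
  define H where "H = delete_verts {v, w} G"
  have H: "pair_graph H" unfolding H_def using G by (rule pair_graph_delete_verts)
  have fH: "undirected_forest H"
    unfolding H_def using assms(1) by (rule undirected_forest_delete_verts)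
  have "card (pverts H) = card (pverts G) - 2"
    using card_Diff_subset[of "{v, w}" "pverts G"] ne by (simp add: H_def)
  moreover have "card (pverts G) \<ge> 2"
    using card_mono[OF F(1), of "{v, w}"] ne by simp
  ultimately have vH: "card (pverts G) = card (pverts H) + 2" by simp
  have R: "R \<subseteq> parcs G" using vw wv by (simp add: R_def)
  have G_H: "parcs H = parcs G - R"
  proof (rule set_eqI, clarify)
    fix a b
    have "b = w" if "(v, b) \<in> parcs G" for b using that nv by auto
    moreover have "b = v \<or> b = u" if "(w, b) \<in> parcs G" for b using that nw by auto
    ultimately show "(a, b) \<in> parcs H \<longleftrightarrow> (a, b) \<in> parcs G - R"
      using F(4)[of a b] by (auto simp: H_def R_def)
  qed
  have cH: "card (parcs H) < card (parcs G)"
    using F(2) vw(1) by (intro psubset_card_mono) (auto simp: G_H R_def)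
  define M' where "M' = {e \<in> M. w \<notin> e}"
  note fM = matching_finite[OF G assms(2)]
  have "e \<in> edges H" if "e \<in> M'" for e
  proof -
    have e: "e \<in> edges G" "w \<notin> e" using that assms(2) by (auto simp: matching_def M'_def)
    then show ?thesis using edge_leaf[OF e(1) G nv] by (auto simp: edges_delete_verts H_def)
  qed
  then have M': "matching H M'" using assms(2) by (auto simp: matching_def M'_def)
  have "card (M - M') \<le> 1"
  proof -
    have "a = b" if "a \<in> M - M'" "b \<in> M - M'" for a b
      using that matching_eqI[OF assms(2), of a b w] by (auto simp: M'_def)
    then show ?thesis using fM by (simp add: card_le_Suc0_iff_eq)
  qed
  then have cM: "card M \<le> card M' + 1"
    using card_Diff_subset[of M' M] fM by (simp add: M'_def)
  define d where "d = real (degree G u)"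
  have nu: "nbrs H u = nbrs G u - {w}"
  proof -
    have "v \<notin> nbrs G u" using F(4)[of u v] ne nv by auto
    moreover have "nbrs H u = nbrs G u - {v, w}"
      unfolding H_def using ne \<open>u \<noteq> v\<close> by (intro nbrs_delete_verts) simp
    ultimately show ?thesis by auto
  qed
  have duH: "degree G u = degree H u + 1"
    unfolding degree_conv_card_nbrs nu
    using wv(2) finite_nbrs[OF G, of u] card.remove[of "nbrs G u" w] by simp
  have dv: "degree G v = 1" "degree G w = 2"
    unfolding degree_conv_card_nbrs nv nw using \<open>u \<noteq> v\<close> by simp_all
  have others: "degree G a = degree H a" if ab: "(a, b) \<in> parcs H" "a \<noteq> u" for a b
  proof -
    have a: "a \<notin> {v, w}" using ab(1) by (simp add: H_def)
    then have "v \<notin> nbrs G a" "w \<notin> nbrs G a" using F(4)[of a v] F(4)[of a w] ab(2) nv nw by auto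
    moreover have "nbrs H a = nbrs G a - {v, w}"
      unfolding H_def using a by (rule nbrs_delete_verts)
    ultimately show ?thesis by (simp add: degree_conv_card_nbrs)
  qed
  let ?w = "\<lambda>(u, v). \<bar>real (degree G u) ^ 2 - real (degree G v) ^ 2\<bar>"
  have "arc_sum G = sum ?w (parcs H) + sum ?w R"
    unfolding arc_sum_def G_H using R F(2) by (rule sum.subset_diff)
  also have "sum ?w R = 6 + 2 * (d ^ 2 - 4)"
  proof -
    \<comment> \<open>This opens the absolute value of d^2 - 4 for the edge between \<open>w\<close>
      and \<open>u\<close>.\<close>
    have "d ^ 2 \<ge> 2 ^ 2" using du by (intro power_mono) (auto simp: d_def)
    then show ?thesis using ne \<open>u \<noteq> v\<close> by (simp add: R_def dv d_def)
  qed
  also have "sum ?w (parcs H) + (6 + 2 * (d ^ 2 - 4))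
      \<le> arc_sum H + 2 * (d - 1) * (2 * d - 1) + (6 + 2 * (d ^ 2 - 4))"
    using arc_sum_peel_le[OF H duH others] by (simp add: d_def)
  finally have "arc_sum G \<le> arc_sum H + 6 * d * (d - 1)"
    by (simp add: algebra_simps power2_eq_square)
  moreover have "card (pverts H) + card M + 1 \<le> card (pverts G) + card M'"
    using vH cM by linarith
  ultimately show ?thesis using fH cH M' unfolding d_def by blast
qed

text \<open>A vertex \<open>w\<close> of degree at least 2 with at most one non-leaf neighbour
  either has two leaves, one of which is deleted with \<open>x = w\<close>, or it has exactly one
  leaf and one further neighbour, and then \<open>w\<close> goes together with its leaf and
  \<open>x\<close> is that neighbour.\<close>

lemma forest_reduction:
  fixes G :: "'a pair_pre_digraph"
  assumes "undirected_forest G" "matching G M" "degree G u \<ge> 2"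
  obtains H :: "'a pair_pre_digraph" and M' x where "undirected_forest H" "matching H M'" "card (parcs H) < card (parcs G)"
    "card (pverts H) + card M + 1 \<le> card (pverts G) + card M'"
    "x \<in> pverts G" "degree G x \<ge> 1"
    "arc_sum G \<le> arc_sum H + 6 * real (degree G x) * (real (degree G x) - 1)"
proof -
  have G: "pair_graph G" using assms(1) by (simp add: undirected_forest_def)
  note F = pair_graph_facts[OF G]
  obtain w where w: "w \<in> pverts G" "degree G w \<ge> 2"
    and I: "card {y \<in> nbrs G w. degree G y \<ge> 2} \<le> 1"
    using undirected_forest_ex_penultimate[OF assms(1,3)] .
  define L where "L = {y \<in> nbrs G w. degree G y < 2}"
  have fin: "finite (nbrs G w)" using G by (rule finite_nbrs)
  have nL: "nbrs G w = L \<union> {y \<in> nbrs G w. degree G y \<ge> 2}" by (auto simp: L_def)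
  have cL: "card (nbrs G w) = card L + card {y \<in> nbrs G w. degree G y \<ge> 2}"
  proof -
    have "L \<inter> {y \<in> nbrs G w. degree G y \<ge> 2} = {}" by (auto simp: L_def)
    then show ?thesis
      using card_Un_disjoint[of L "{y \<in> nbrs G w. degree G y \<ge> 2}"] fin nL
      by (metis finite_Un)
  qed
  show ?thesis
  proof (cases "\<exists>v\<in>L. \<exists>v'\<in>L. v \<noteq> v'")
    case True
    then obtain v v' where "v \<in> L" "v' \<in> L" "v \<noteq> v'" by blast
    then have "(w, v) \<in> parcs G" "(w, v') \<in> parcs G" "nbrs G v = {w}" "nbrs G v' = {w}"
      using nbrs_leaf[OF G] by (auto simp: L_def)
    with forest_remove_leaf[OF assms(1,2) this(1,2) \<open>v \<noteq> v'\<close>] w that[of _ _ w]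
    show ?thesis by auto
  next
    case False
    have "finite L" by (rule finite_subset[OF _ fin]) (auto simp: L_def)
    with False have "card L \<le> 1" by (auto simp: card_le_Suc0_iff_eq)
    \<comment> \<open>Two numbers that are at most 1 and add up to at least 2.\<close>
    then have c: "card L = 1" "card {y \<in> nbrs G w. degree G y \<ge> 2} = 1" "card (nbrs G w) = 2"
      using cL I w(2) by (auto simp: degree_conv_card_nbrs)
    obtain v where v: "L = {v}" using c(1) by (auto simp: card_1_singleton_iff)
    \<comment> \<open>From here on \<open>u\<close> is the non-leaf neighbour of \<open>w\<close>
      and no longer the vertex of the hypothesis.\<close>
    obtain u where u: "{y \<in> nbrs G w. degree G y \<ge> 2} = {u}"
      using c(2) by (auto simp: card_1_singleton_iff)
    have nw: "nbrs G w = {v, u}" using nL u v by auto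
    have du: "degree G u \<ge> 2" and dv: "degree G v < 2" using u v by (auto simp: L_def)
    have "nbrs G v = {w}" using nbrs_leaf[OF G _ dv] nw by auto
    moreover have "u \<in> pverts G" using F(7)[of w u] nw by auto
    moreover have "u \<noteq> v" using du dv by auto
    ultimately show ?thesis
      using forest_remove_pendant_path[OF assms(1,2) _ nw _ du] du that[of _ _ u] by auto
  qed
qed

section \<open>Degrees bounded by means of a matching\<close>

text \<open>Otherwise \<open>v\<close>, \<open>a\<close> and \<open>b\<close> would form a
  triangle.\<close>

lemma undirected_forest_nbrs_independent:
  assumes "undirected_forest G" "(v, a) \<in> parcs G" "(v, b) \<in> parcs G"
  shows "(a, b) \<notin> parcs G"
proof
  assume ab: "(a, b) \<in> parcs G"
  have G: "pair_graph G" using assms(1) by (simp add: undirected_forest_def)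
  note F = pair_graph_facts[OF G]
  have "{v, a, b} = {}"
  proof (rule undirected_forest_no_two_nbrs[OF assms(1)])
    show "{v, a, b} \<subseteq> pverts G" using F(6,7) assms(2,3) by blast
    fix x assume "x \<in> {v, a, b}"
    then consider "x = v" | "x = a" | "x = b" by blast
    then show "\<exists>y z. y \<noteq> z \<and> y \<in> {v, a, b} \<and> z \<in> {v, a, b} \<and> (x, y) \<in> parcs G \<and> (x, z) \<in> parcs G"
    proof cases
      case 1
      then show ?thesis using assms(2,3) F(5)[OF ab] by blast
    next
      case 2
      then show ?thesis using ab F(4)[OF assms(2)] F(5)[OF assms(3)] by blast
    next
      case 3
      then show ?thesis using F(4)[OF ab] F(4)[OF assms(3)] F(5)[OF assms(2)] by blast
    qed
  qed
  then show False by simp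
qed

text \<open>An edge has an end that is no neighbour of \<open>v\<close>, because neighbours of
  \<open>v\<close> are not adjacent. Matching edges are disjoint, so choosing such ends is
  injective.\<close>

lemma matching_choose_non_nbr:
  assumes "undirected_forest G" "matching G M"
  obtains h where "inj_on h M" "h ` M \<subseteq> pverts G - nbrs G v" "\<And>e. e \<in> M \<Longrightarrow> h e \<in> e"
proof -
  have G: "pair_graph G" using assms(1) by (simp add: undirected_forest_def)
  note F = pair_graph_facts[OF G]
  have "\<exists>x\<in>e. x \<in> pverts G - nbrs G v" if e: "e \<in> M" for e
  proof -
    obtain a b where ab: "e = {a, b}" "(a, b) \<in> parcs G"
      using e assms(2) by (auto simp: matching_def edges_def)
    then show ?thesis
      using undirected_forest_nbrs_independent[OF assms(1), of v a b] F(6,7)[OF ab(2)] by auto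
  qed
  then obtain h where h: "\<And>e. e \<in> M \<Longrightarrow> h e \<in> e \<and> h e \<in> pverts G - nbrs G v" by metis
  moreover have "inj_on h M"
  proof (rule inj_onI)
    fix e f assume "e \<in> M" "f \<in> M" "h e = h f"
    then show "e = f" using matching_eqI[OF assms(2), of e f "h e"] h[of e] h[of f] by auto
  qed
  ultimately show ?thesis using that by blast
qed

text \<open>The chosen ends of the matching edges and the neighbours of \<open>v\<close> are
  disjoint sets of vertices.\<close>

lemma card_matching_add_degree_le:
  assumes "undirected_forest G" "matching G M"
  shows "card M + degree G v \<le> card (pverts G)"
proof -
  have G: "pair_graph G" using assms(1) by (simp add: undirected_forest_def)
  note F = pair_graph_facts[OF G]
  obtain h where h: "inj_on h M" "h ` M \<subseteq> pverts G - nbrs G v"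
    using matching_choose_non_nbr[OF assms] by metis
  have sub: "nbrs G v \<subseteq> pverts G" using F(7) by auto
  have "card M = card (h ` M)" using h(1) by (simp add: card_image)
  also have "\<dots> \<le> card (pverts G - nbrs G v)" using h(2) F(1) by (intro card_mono) auto
  also have "\<dots> = card (pverts G) - degree G v"
    unfolding degree_conv_card_nbrs using finite_nbrs[OF G] sub by (rule card_Diff_subset)
  finally show ?thesis
    using card_mono[OF F(1) sub] by (simp add: degree_conv_card_nbrs)
qed

section \<open>The bound by induction, with the degree forced by equality\<close>

lemma cubic_nonneg: "(real n - 1) * real n * (real n + 1) \<ge> 0"
  by (cases n) auto

lemma cubic_mono:
  assumes "m \<le> n"
  shows "(real m - 1) * real m * (real m + 1) \<le> (real n - 1) * real n * (real n + 1)"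
\<comment> \<open>For \<open>m = 0\<close> the factor \<open>real m - 1\<close> is negative, so the
  factors cannot be compared one by one.\<close>
proof (cases "m = 0")
  case True
  then show ?thesis using cubic_nonneg[of n] by simp
next
  case False
  then show ?thesis using assms by (intro mult_mono) auto
qed

text \<open>The matching is arbitrary because the reductions supply \<open>M'\<close> without any
  claim of maximality. Equality is read off from the last reduction alone. If no reduction applies,
  a nonempty \<open>M\<close> supplies an edge, whose ends have degree 1.\<close>

lemma arc_sum_forest_le:
  fixes G :: "'a pair_pre_digraph"
  assumes "undirected_forest G" "matching G M" "card (pverts G) = card M + D"
  shows "arc_sum G \<le> 2 * ((real D - 1) * real D * (real D + 1))
    \<and> (M \<noteq> {} \<longrightarrow> arc_sum G = 2 * ((real D - 1) * real D * (real D + 1)) \<longrightarrow>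
         (\<exists>v\<in>pverts G. degree G v = D))"
  using assms
proof (induction "card (parcs G)" arbitrary: G M D rule: less_induct)
  case less
  note forest = \<open>undirected_forest G\<close> and M = \<open>matching G M\<close> and D = \<open>card (pverts G) = card M + D\<close>
  have G: "pair_graph G" using forest by (simp add: undirected_forest_def)
  note F = pair_graph_facts[OF G]
  have deg_le: "degree G v \<le> D" for v
    using card_matching_add_degree_le[OF forest M, of v] D by linarith
  let ?f = "\<lambda>n. (real n - 1) * real n * (real n + 1)"
  show ?case
  proof (cases "\<exists>u. degree G u \<ge> 2")
    case True
    then obtain u where "degree G u \<ge> 2" by blast
    then obtain H :: "'a pair_pre_digraph" and M' x where
      H: "undirected_forest H" "matching H M'" "card (parcs H) < card (parcs G)"
      and cH: "card (pverts H) + card M + 1 \<le> card (pverts G) + card M'"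
      and x: "x \<in> pverts G" "degree G x \<ge> 1"
      and le: "arc_sum G \<le> arc_sum H + 6 * real (degree G x) * (real (degree G x) - 1)"
      by (rule forest_reduction[OF forest M])
    \<comment> \<open>The subtraction is not truncated, since a matching has at most as many edges
      as there are vertices.\<close>
    define D' where "D' = card (pverts H) - card M'"
    have D': "card (pverts H) = card M' + D'"
      using card_matching_add_degree_le[OF H(1,2), of x] by (simp add: D'_def)
    define d where "d = degree G x"
    have d: "1 \<le> d" "d \<le> D" using x(2) deg_le by (auto simp: d_def)
    have "D' \<le> D - 1" using D D' cH by linarith
    then have "?f D' \<le> ?f (D - 1)" by (rule cubic_mono)
    moreover have "arc_sum H \<le> 2 * ?f D'"
      using less.hyps[OF H(3,1,2) D'] by blast
    moreover have "2 * ?f (D - 1) + 6 * real D * (real D - 1) = 2 * ?f D"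
      using d by (simp add: of_nat_diff algebra_simps)
    \<comment> \<open>The slack D(D-1) - d(d-1) in factored form, which shows its sign: zero for d =
      D and positive for 1 \<le> d < D.\<close>
    moreover define p where "p = (real D - real d) * (real D + real d - 1)"
    moreover have "p = real D * (real D - 1) - real d * (real d - 1)"
      by (simp add: p_def algebra_simps)
    ultimately have *: "arc_sum G \<le> 2 * ?f D - 6 * p"
      using le unfolding d_def[symmetric] by (simp add: algebra_simps)
    have "p \<ge> 0"
      using d unfolding p_def by (intro mult_nonneg_nonneg) auto
    then have "arc_sum G \<le> 2 * ?f D" using * by simp
    moreover have "d = D" if eq: "arc_sum G = 2 * ?f D"
    proof (rule ccontr)
      assume "d \<noteq> D"
      then have "p > 0"
        using d unfolding p_def by (intro mult_pos_pos) auto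
      then show False using * eq by simp
    qed
    ultimately show ?thesis using x(1) by (auto simp: d_def)
  next
    case False
    have deg1: "degree G a = 1" if "(a, b) \<in> parcs G" for a b
      using degree_pos_iff[OF G, of a] that False by (metis le_antisym not_less_eq_eq one_add_one plus_1_eq_Suc)
    have "\<bar>real (degree G a) ^ 2 - real (degree G b) ^ 2\<bar> = 0" if ab: "(a, b) \<in> parcs G" for a b
      using deg1[OF ab] deg1[OF F(4)[OF ab]] by simp
    then have 0: "arc_sum G = 0"
      unfolding arc_sum_def by (intro sum.neutral) auto
    have "\<exists>v\<in>pverts G. degree G v = D" if "M \<noteq> {}" "arc_sum G = 2 * ?f D"
    proof -
      obtain e where "e \<in> edges G" using M \<open>M \<noteq> {}\<close> by (auto simp: matching_def)
      then obtain a b where ab: "(a, b) \<in> parcs G" by (auto simp: edges_def)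
      \<comment> \<open>The arc sum is 0 here, so the cubic vanishes. Together with 1 =
        \<open>degree G a\<close> \<le> \<open>D\<close> this leaves \<open>D = 1\<close>.\<close>
      have "D \<le> 1"
      proof (rule ccontr)
        assume "\<not> D \<le> 1"
        then have "?f D > 0" by (intro mult_pos_pos) auto
        then show False using that 0 by linarith
      qed
      moreover have "degree G a = 1" using ab by (rule deg1)
      ultimately have "degree G a = D" using deg_le[of a] by linarith
      then show ?thesis using F(6)[OF ab] by blast
    qed
    then show ?thesis using 0 cubic_nonneg[of D] by auto
  qed
qed

section \<open>Spiders, the extremal trees\<close>

text \<open>
  A star with centre \<open>c\<close> some of whose edges are subdivided: \<open>X\<close> is the set of vertices at
  distance two from \<open>c\<close>, and \<open>m x\<close> lies between \<open>c\<close> and \<open>x\<close>.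
\<close>

definition spider :: "'a pair_pre_digraph \<Rightarrow> 'a \<Rightarrow> 'a set \<Rightarrow> ('a \<Rightarrow> 'a) \<Rightarrow> bool" where
  "spider G c X m \<longleftrightarrow> finite (pverts G) \<and> c \<in> pverts G \<and> X \<subseteq> pverts G - {c} \<and>
     inj_on m X \<and> m ` X \<subseteq> pverts G - insert c X \<and>
     (\<forall>u v. (u, v) \<in> parcs G \<longleftrightarrow>
        (u = c \<and> v \<in> pverts G - insert c X) \<or> (v = c \<and> u \<in> pverts G - insert c X) \<or>
        (u \<in> X \<and> v = m u) \<or> (v \<in> X \<and> u = m v))"

lemma spiderD:
  assumes "spider G c X m"
  shows "finite (pverts G)" "c \<in> pverts G" "X \<subseteq> pverts G" "c \<notin> X" "finite X"
    and "inj_on m X" "m ` X \<subseteq> pverts G - insert c X"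
    and "\<forall>x\<in>X. m x \<in> pverts G \<and> m x \<noteq> c \<and> m x \<notin> X"
    and "(u, v) \<in> parcs G \<longleftrightarrow>
        (u = c \<and> v \<in> pverts G - insert c X) \<or> (v = c \<and> u \<in> pverts G - insert c X) \<or>
        (u \<in> X \<and> v = m u) \<or> (v \<in> X \<and> u = m v)"
  using assms unfolding spider_def by (auto dest: finite_subset)

lemma spider_nbrs:
  assumes "spider G c X m"
  shows "nbrs G c = pverts G - insert c X"
    and "x \<in> X \<Longrightarrow> nbrs G x = {m x}"
    and "x \<in> X \<Longrightarrow> nbrs G (m x) = {c, x}"
    and "y \<in> pverts G - insert c X - m ` X \<Longrightarrow> nbrs G y = {c}"
proof -
  note S = spiderD[OF assms]
  show "nbrs G c = pverts G - insert c X"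
    using S(3,4,8) by (auto simp: S(9))
  show "nbrs G x = {m x}" if "x \<in> X"
    using that S(3,4,8) by (auto simp: S(9))
  show "nbrs G (m x) = {c, x}" if "x \<in> X"
    using that S(3,4,8) inj_onD[OF S(6)] by (auto simp: S(9))
  show "nbrs G y = {c}" if "y \<in> pverts G - insert c X - m ` X"
    using that S(3,4,8) by (auto simp: S(9))
qed

lemma spider_pair_graph:
  assumes "spider G c X m"
  shows "pair_graph G"
proof (rule pair_graphI)
  note S = spiderD[OF assms]
  show "finite (pverts G)" by fact
  have "(u, v) \<in> parcs G \<Longrightarrow> u \<in> pverts G \<and> u \<noteq> v \<and> (v, u) \<in> parcs G" for u v
    using S(2-4,8) by (auto simp: S(9))
  note * = this
  then show "(u, v) \<in> parcs G \<Longrightarrow> u \<in> pverts G \<and> u \<noteq> v \<and> (v, u) \<in> parcs G" for u v .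
  have "parcs G \<subseteq> pverts G \<times> pverts G"
  proof (rule subrelI)
    fix u v assume "(u, v) \<in> parcs G"
    then show "(u, v) \<in> pverts G \<times> pverts G" using *[of u v] *[of v u] by simp
  qed
  then show "finite (parcs G)" using S(1) finite_subset by blast
qed

text \<open>The centre has card X neighbours of degree 2 and D - card X leaves. Per direction this
  gives card X (D^2 - 4) + (D - card X)(D^2 - 1), and the outer edges add 3 card X. The size of
  \<open>X\<close> cancels and D^3 - D remains.\<close>

lemma arc_sum_spider:
  assumes "spider G c X m" and D: "degree G c = D" and X: "card X < D"
  shows "arc_sum G = 2 * ((real D - 1) * real D * (real D + 1))"
proof -
  note S = spiderD[OF assms(1)] and N = spider_nbrs[OF assms(1)]
  define Y where "Y = pverts G - insert c X"
  define Z where "Z = Y - m ` X"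
  have fin: "finite Y" "finite Z" "finite X" using S(1,5) by (auto simp: Y_def Z_def)
  have deg: "degree G c = D" "\<And>x. x \<in> X \<Longrightarrow> degree G x = 1"
    "\<And>x. x \<in> X \<Longrightarrow> degree G (m x) = 2" "\<And>y. y \<in> Z \<Longrightarrow> degree G y = 1"
    using D N(2,3,4) S(4) by (auto simp: degree_conv_card_nbrs Z_def Y_def card_insert_if)
  have cY: "card Y = D" using D by (simp add: degree_conv_card_nbrs N(1) Y_def)
  have mX: "m ` X \<subseteq> Y" using S(7) by (simp add: Y_def)
  have cmX: "card (m ` X) = card X" using S(6) by (rule card_image)
  have cZ: "real (card Z) = real D - real (card X)"
    using card_Diff_subset[of "m ` X" Y] card_mono[OF fin(1) mX] mX fin cY cmX
    by (simp add: Z_def of_nat_diff)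
  let ?w = "\<lambda>(u, v). \<bar>real (degree G u) ^ 2 - real (degree G v) ^ 2\<bar>"
  \<comment> \<open>One orientation of each edge: \<open>A\<close> leads away from the centre,
    \<open>B\<close> from the outer vertices inwards. The swapped arcs double the sum.\<close>
  define A where "A = (\<lambda>y. (c, y)) ` Y"
  define B where "B = (\<lambda>x. (x, m x)) ` X"
  have arcs: "parcs G = (A \<union> B) \<union> prod.swap ` (A \<union> B)"
  proof -
    have "prod.swap ` (A \<union> B) = (\<lambda>y. (y, c)) ` Y \<union> (\<lambda>x. (m x, x)) ` X"
      by (simp add: A_def B_def image_Un image_image)
    then show ?thesis by (auto simp: S(9) A_def B_def Y_def)
  qed
  have sumA: "sum ?w A = (real D)\<^sup>2 * real D - real D - 3 * real (card X)"
  proof -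
    have "sum ?w A = (\<Sum>y\<in>Y. \<bar>real D ^ 2 - real (degree G y) ^ 2\<bar>)"
      unfolding A_def by (subst sum.reindex) (auto simp: inj_on_def deg(1))
    also have "\<dots> = (\<Sum>y\<in>Z. \<bar>real D ^ 2 - real (degree G y) ^ 2\<bar>)
        + (\<Sum>y\<in>m ` X. \<bar>real D ^ 2 - real (degree G y) ^ 2\<bar>)"
      unfolding Z_def using mX fin(1) by (rule sum.subset_diff)
    also have "(\<Sum>y\<in>Z. \<bar>real D ^ 2 - real (degree G y) ^ 2\<bar>) = (\<Sum>y\<in>Z. real D ^ 2 - 1)"
      using X by (intro sum.cong) (auto simp: deg(4))
    also have "(\<Sum>y\<in>m ` X. \<bar>real D ^ 2 - real (degree G y) ^ 2\<bar>) = (\<Sum>y\<in>m ` X. real D ^ 2 - 4)"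
    proof (rule sum.cong[OF refl])
      fix y assume y: "y \<in> m ` X"
      \<comment> \<open>A nonempty \<open>X\<close> with \<open>card X < D\<close> yields
        \<open>D \<ge> 2\<close>, hence D^2 - 4 is nonnegative.\<close>
      then have "card X \<ge> 1" using fin(3) by (auto simp: Suc_le_eq card_gt_0_iff)
      then have "real D ^ 2 \<ge> 2 ^ 2" using X by (intro power_mono) auto
      then show "\<bar>real D ^ 2 - real (degree G y) ^ 2\<bar> = real D ^ 2 - 4" using y deg(3) by auto
    qed
    finally show ?thesis by (simp add: cmX cZ algebra_simps)
  qed
  have sumB: "sum ?w B = 3 * real (card X)"
  proof -
    have "sum ?w B = (\<Sum>x\<in>X. 3)"
      unfolding B_def by (subst sum.reindex) (auto simp: inj_on_def deg(2,3))
    then show ?thesis by simp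
  qed
  have "A \<inter> B = {}" using S(4) by (auto simp: A_def B_def)
  then have AB: "sum ?w (A \<union> B) = (real D)\<^sup>2 * real D - real D"
    using sumA sumB fin by (subst sum.union_disjoint) (auto simp: A_def B_def)
  have "sum ?w (prod.swap ` (A \<union> B)) = sum ?w (A \<union> B)"
    by (subst sum.reindex) (auto intro!: sum.cong simp: abs_minus_commute)
  moreover have "(A \<union> B) \<inter> prod.swap ` (A \<union> B) = {}"
    using S(4,7) by (auto simp: A_def B_def Y_def)
  ultimately have "arc_sum G = 2 * ((real D)\<^sup>2 * real D - real D)"
    unfolding arc_sum_def arcs using AB fin
    by (subst sum.union_disjoint) (auto simp: A_def B_def)
  then show ?thesis by (simp add: algebra_simps power2_eq_square)
qed

section \<open>Isomorphism of spiders\<close>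

text \<open>A library isomorphism also maps arcs, tails and heads. As arcs are pairs here, the
  vertex map \<open>g\<close> determines the rest: \<open>map_prod g g\<close>, \<open>fst\<close>
  and \<open>snd\<close>.\<close>

lemma digraph_isoI:
  assumes "pair_wf_digraph G" "bij_betw g (pverts G) (pverts H)"
    and "parcs H \<subseteq> pverts H \<times> pverts H"
    and "\<And>u v. u \<in> pverts G \<Longrightarrow> v \<in> pverts G \<Longrightarrow> (g u, g v) \<in> parcs H \<longleftrightarrow> (u, v) \<in> parcs G"
  shows "digraph_iso (with_proj G) (with_proj H)"
proof -
  have arcs: "parcs G \<subseteq> pverts G \<times> pverts G"
    using pair_wf_digraph.arc_fst_in_verts[OF assms(1)] pair_wf_digraph.arc_snd_in_verts[OF assms(1)]
    by fastforce
  have inj: "inj_on g (pverts G)" and img: "g ` pverts G = pverts H"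
    using assms(2) by (auto simp: bij_betw_def)
  let ?f = "\<lparr>iso_verts = g, iso_arcs = map_prod g g, iso_head = snd, iso_tail = fst\<rparr>"
  have "inj_on (map_prod g g) (parcs G)"
    using inj_on_subset[OF map_prod_inj_on[OF inj inj] arcs] .
  then have "pre_digraph.digraph_isomorphism (with_proj G) ?f"
    using assms(1) inj by (auto simp: pre_digraph.digraph_isomorphism_def wf_digraph_wp_iff)
  moreover have "parcs H = map_prod g g ` parcs G"
  proof
    show "map_prod g g ` parcs G \<subseteq> parcs H" using arcs assms(4) by auto
    show "parcs H \<subseteq> map_prod g g ` parcs G"
    proof clarify
      fix a b assume ab: "(a, b) \<in> parcs H"
      then obtain u v where "u \<in> pverts G" "v \<in> pverts G" "a = g u" "b = g v"
        using assms(3) img by blast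
      then show "(a, b) \<in> map_prod g g ` parcs G" using ab assms(4) by force
    qed
  qed
  then have "with_proj H = app_iso ?f (with_proj G)"
    by (simp add: app_iso_def with_proj_def img)
  ultimately show ?thesis unfolding digraph_iso_def by blast
qed

text \<open>A spider splits into the centre, the outer vertices, the middle vertices and the leaves
  at the centre. The two given cardinalities fix the sizes of all four classes, which are then
  matched class by class.\<close>

lemma spider_iso:
  assumes G: "spider G c X m" and H: "spider H c' X' m'"
    and "card (pverts G) = card (pverts H)" "card X = card X'"
  shows "digraph_iso (with_proj G) (with_proj H)"
proof -
  note SG = spiderD[OF G] and SH = spiderD[OF H]
  define Z where "Z = pverts G - insert c X - m ` X"
  define Z' where "Z' = pverts H - insert c' X' - m' ` X'"
  have card_Z: "card (pverts K) = 1 + card Y + card Y + card (pverts K - insert d Y - k ` Y)"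
    if K: "spider K d Y k" for K d Y k
  proof -
    note S = spiderD[OF K]
    have *: "insert d Y \<union> k ` Y \<subseteq> pverts K" using S(2,3,7) by blast
    have "card (insert d Y \<union> k ` Y) = 1 + card Y + card Y"
      using S(4,5,7) card_image[OF S(6)] by (subst card_Un_disjoint) auto
    moreover have "card (pverts K - (insert d Y \<union> k ` Y)) = card (pverts K) - card (insert d Y \<union> k ` Y)"
      using finite_subset[OF * S(1)] * by (rule card_Diff_subset)
    moreover have "pverts K - (insert d Y \<union> k ` Y) = pverts K - insert d Y - k ` Y" by blast
    ultimately show ?thesis using card_mono[OF S(1) *] by simp
  qed
  have "card Z = card Z'"
    using card_Z[OF G] card_Z[OF H] assms(3,4) by (simp add: Z_def Z'_def)
  then obtain z where z: "bij_betw z Z Z'"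
    using SG(1) SH(1) by (metis Z_def Z'_def finite_Diff finite_same_card_bij)
  obtain x where x: "bij_betw x X X'"
    using SG(5) SH(5) assms(4) by (metis finite_same_card_bij)
  \<comment> \<open>A middle vertex has to follow its outer vertex, which
    \<open>the_inv_into X m\<close> recovers.\<close>
  define g where "g u = (if u = c then c' else if u \<in> X then x u
      else if u \<in> m ` X then m' (x (the_inv_into X m u)) else z u)" for u
  have gc: "g c = c'" by (simp add: g_def)
  have gX: "g u = x u" if "u \<in> X" for u using that SG(4) by (auto simp: g_def)
  have gm: "g (m u) = m' (x u)" if "u \<in> X" for u
    using that SG(6,7) by (auto simp: g_def the_inv_into_f_f)
  have gZ: "g u = z u" if "u \<in> Z" for u using that by (auto simp: g_def Z_def)
  have bX: "bij_betw g X X'" using x gX by (simp cong: bij_betw_cong)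
  have bZ: "bij_betw g Z Z'" using z gZ by (simp cong: bij_betw_cong)
  have bc: "bij_betw g {c} {c'}" by (simp add: gc bij_betw_def)
  have bm: "bij_betw g (m ` X) (m' ` X')"
  proof -
    have "bij_betw (m' \<circ> x) X (m' ` X')"
      using x SH(6) by (meson bij_betw_trans inj_on_imp_bij_betw)
    then have "bij_betw (g \<circ> m) X (m' ` X')"
      using gm by (simp cong: bij_betw_cong)
    then show ?thesis
      using SG(6) by (simp add: bij_betw_def inj_on_imageI image_comp)
  qed
  have "bij_betw g ({c} \<union> X \<union> (m ` X \<union> Z)) ({c'} \<union> X' \<union> (m' ` X' \<union> Z'))"
    using SG(4,7) SH(4,7)
    by (intro bij_betw_combine bc bX bm bZ) (auto simp: Z_def Z'_def)
  moreover have "{c} \<union> X \<union> (m ` X \<union> Z) = pverts G" using SG(2,3,7) by (auto simp: Z_def)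
  moreover have "{c'} \<union> X' \<union> (m' ` X' \<union> Z') = pverts H" using SH(2,3,7) by (auto simp: Z'_def)
  ultimately have bij: "bij_betw g (pverts G) (pverts H)" by simp
  then have inj: "g u = g v \<longleftrightarrow> u = v" if "u \<in> pverts G" "v \<in> pverts G" for u v
    using that by (auto simp: bij_betw_def inj_on_def)
  have memV: "g u \<in> pverts H" if "u \<in> pverts G" for u using bij that by (auto simp: bij_betw_def)
  have memc: "g u = c' \<longleftrightarrow> u = c" if "u \<in> pverts G" for u using inj[OF that SG(2)] gc by simp
  have memX: "g u \<in> X' \<longleftrightarrow> u \<in> X" if "u \<in> pverts G" for u
    using inj[OF that] SG(3) bX by (fastforce simp: bij_betw_def)
  have m: "g v = m' (g u) \<longleftrightarrow> v = m u" if "u \<in> X" "v \<in> pverts G" for u v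
    using inj[OF that(2), of "m u"] SG(7) that(1) gm gX by auto
  have "pair_wf_digraph G" "pair_graph H"
    using spider_pair_graph[OF G] spider_pair_graph[OF H] pair_graph_facts(3)
    by (auto intro: pair_fin_digraph.axioms)
  moreover have "(g u, g v) \<in> parcs H \<longleftrightarrow> (u, v) \<in> parcs G"
    if "u \<in> pverts G" "v \<in> pverts G" for u v
  proof -
    have "g u \<in> X' \<and> g v = m' (g u) \<longleftrightarrow> u \<in> X \<and> v = m u"
      and "g v \<in> X' \<and> g u = m' (g v) \<longleftrightarrow> v \<in> X \<and> u = m v"
      using memX m that by blast+
    then show ?thesis
      unfolding SG(9) SH(9)
      by (simp only: Diff_iff insert_iff that memV[OF that(1)] memV[OF that(2)]
          memc[OF that(1)] memc[OF that(2)] memX[OF that(1)] memX[OF that(2)])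
  qed
  ultimately show ?thesis
    using bij pair_graph_facts(6,7) by (intro digraph_isoI[of _ g]) auto
qed

section \<open>A vertex of the largest possible degree forces a spider\<close>

text \<open>The cardinality hypothesis makes the chosen ends exhaust the non-neighbours of
  \<open>c\<close>. Each non-neighbour is thus matched with a neighbour of \<open>c\<close>, and any
  arc beyond those of the spider would close a cycle of length 3, 4 or 5.\<close>

lemma spider_if_degree_max:
  assumes forest: "undirected_forest G" and M: "matching G M"
    and c: "c \<in> pverts G" and card: "card (pverts G) = card M + degree G c"
  obtains X m where "spider G c X m" "card X + 1 = card M"
proof -
  have G: "pair_graph G" using forest by (simp add: undirected_forest_def)
  note F = pair_graph_facts[OF G]
  define U where "U = pverts G - nbrs G c"
  have sub: "nbrs G c \<subseteq> pverts G" using F(7) by auto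
  have cU: "c \<in> U" using c F(5)[of c c] by (auto simp: U_def)
  have finU: "finite U" using F(1) by (simp add: U_def)
  have cardU: "card U = card M"
    using card_Diff_subset[OF finite_nbrs[OF G] sub] card by (simp add: U_def degree_conv_card_nbrs)
  obtain h where h: "inj_on h M" "h ` M \<subseteq> U" "\<And>e. e \<in> M \<Longrightarrow> h e \<in> e"
    using matching_choose_non_nbr[OF forest M, of c] unfolding U_def by metis
  have hU: "h ` M = U"
    using finU h(2) cardU card_image[OF h(1)] by (intro card_subset_eq) auto
  have mate: "\<exists>y. {x, y} \<in> M \<and> h {x, y} = x \<and> (x, y) \<in> parcs G \<and> (c, y) \<in> parcs G"
    if x: "x \<in> U" for x
  proof -
    obtain e where e: "e \<in> M" "h e = x" using x hU by blast
    obtain a b where ab: "e = {a, b}" "(a, b) \<in> parcs G"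
      using e(1) M by (auto simp: matching_def edges_def)
    obtain y where y: "e = {x, y}" "(x, y) \<in> parcs G"
    proof -
      have "x = a \<or> x = b" using h(3)[OF e(1)] e(2) ab(1) by simp
      then show ?thesis
        using that[of a] that[of b] ab F(4)[OF ab(2)] by (auto simp: insert_commute)
    qed
    \<comment> \<open>If \<open>y\<close> were in \<open>U\<close>, it would be the chosen end of a
      matching edge. That edge meets \<open>e\<close> and hence equals \<open>e\<close>, whose
      chosen end is \<open>x\<close>.\<close>
    have "y \<notin> U"
    proof
      assume "y \<in> U"
      then obtain e' where e': "e' \<in> M" "h e' = y" using hU by blast
      then have "e' = e" using matching_eqI[OF M e'(1) e(1), of y] h(3)[OF e'(1)] y(1) by simp
      then show False using e(2) e'(2) F(5)[OF y(2)] by simp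
    qed
    then have "(c, y) \<in> parcs G" using F(7)[OF y(2)] by (simp add: U_def)
    moreover have "{x, y} \<in> M" "h {x, y} = x" using e y(1) by simp_all
    ultimately show ?thesis using y(2) by blast
  qed
  then obtain m where m: "\<And>x. x \<in> U \<Longrightarrow>
      {x, m x} \<in> M \<and> h {x, m x} = x \<and> (x, m x) \<in> parcs G \<and> (c, m x) \<in> parcs G"
    by metis
  have inj: "inj_on m U"
  proof (rule inj_onI)
    fix x y assume xy: "x \<in> U" "y \<in> U" "m x = m y"
    have "{x, m x} = {y, m y}"
      by (rule matching_eqI[OF M, of _ _ "m x"]) (use m[OF xy(1)] m[OF xy(2)] xy(3) in simp_all)
    then show "x = y" using m[OF xy(1)] m[OF xy(2)] by metis
  qed
  \<comment> \<open>The vertex \<open>c\<close> is itself a non-neighbour of \<open>c\<close> and is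
    matched too, which explains why \<open>X\<close> has one element fewer than
    \<open>M\<close>.\<close>
  define X where "X = U - {c}"
  have X_conv: "X = {w \<in> pverts G. w \<noteq> c \<and> (c, w) \<notin> parcs G}"
    by (auto simp: X_def U_def)
  have Y: "pverts G - insert c X = nbrs G c"
    using F(7)[of c] F(5)[of c c] by (auto simp: X_conv)
  have XD: "x \<in> U" "x \<noteq> c" "(c, x) \<notin> parcs G" "(x, c) \<notin> parcs G" "(x, m x) \<in> parcs G"
    "(c, m x) \<in> parcs G" "m x \<noteq> c" "x \<in> pverts G" if "x \<in> X" for x
    using that m[of x] F(4)[of x c] F(5)[of c "m x"] by (auto simp: X_def U_def)
  have indep: "(a, b) \<notin> parcs G" if "(c, a) \<in> parcs G" "(c, b) \<in> parcs G" for a b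
    using undirected_forest_nbrs_independent[OF forest that] .
  have no_XX: "(x, x') \<notin> parcs G" if x: "x \<in> X" "x' \<in> X" for x x'
  proof
    assume a: "(x, x') \<in> parcs G"
    have ne: "x \<noteq> x'" using F(5)[OF a] .
    then have mne: "m x \<noteq> m x'" using inj XD(1)[OF x(1)] XD(1)[OF x(2)] by (auto dest: inj_onD)
    \<comment> \<open>otherwise these five vertices form a cycle\<close>
    let ?S = "{c, m x, x, x', m x'}"
    have "?S = {}"
    proof (rule undirected_forest_no_two_nbrs[OF forest])
      show "?S \<subseteq> pverts G" using XD[OF x(1)] XD[OF x(2)] F(6,7) c by blast
      fix y assume "y \<in> ?S"
      then consider "y = c" | "y = m x" | "y = x" | "y = x'" | "y = m x'" by blast
      then show "\<exists>a b. a \<noteq> b \<and> a \<in> ?S \<and> b \<in> ?S \<and> (y, a) \<in> parcs G \<and> (y, b) \<in> parcs G"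
      proof cases
        case 1
        then show ?thesis using XD(6)[OF x(1)] XD(6)[OF x(2)] mne by blast
      next
        case 2
        then show ?thesis using F(4)[OF XD(6)[OF x(1)]] F(4)[OF XD(5)[OF x(1)]] XD(2)[OF x(1)] by blast
      next
        case 3
        have "m x \<noteq> x'" using XD(3)[OF x(2)] XD(6)[OF x(1)] by auto
        then show ?thesis using 3 a XD(5)[OF x(1)] by blast
      next
        case 4
        have "m x' \<noteq> x" using XD(3)[OF x(1)] XD(6)[OF x(2)] by auto
        then show ?thesis using 4 F(4)[OF a] XD(5)[OF x(2)] by blast
      next
        case 5
        then show ?thesis using F(4)[OF XD(6)[OF x(2)]] F(4)[OF XD(5)[OF x(2)]] XD(2)[OF x(2)] by blast
      qed
    qed
    then show False by simp
  qed
  have mate_unique: "y = m x" if x: "x \<in> X" and y: "(x, y) \<in> parcs G" "(c, y) \<in> parcs G" for x y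
  proof (rule ccontr)
    \<comment> \<open>A second common neighbour of \<open>x\<close> and \<open>c\<close> closes a
      cycle of length four.\<close>
    assume ne: "y \<noteq> m x"
    let ?S = "{c, m x, x, y}"
    have "?S = {}"
    proof (rule undirected_forest_no_two_nbrs[OF forest])
      show "?S \<subseteq> pverts G" using XD[OF x] F(7) y c by blast
      fix z assume "z \<in> ?S"
      then consider "z = c" | "z = m x" | "z = x" | "z = y" by blast
      then show "\<exists>a b. a \<noteq> b \<and> a \<in> ?S \<and> b \<in> ?S \<and> (z, a) \<in> parcs G \<and> (z, b) \<in> parcs G"
      proof cases
        case 1
        then show ?thesis using XD(6)[OF x] y ne by blast
      next
        case 2
        then show ?thesis using F(4)[OF XD(6)[OF x]] F(4)[OF XD(5)[OF x]] XD(2)[OF x] by blast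
      next
        case 3
        then show ?thesis using y XD(5)[OF x] ne by blast
      next
        case 4
        then show ?thesis using F(4)[OF y(1)] F(4)[OF y(2)] XD(2)[OF x] by blast
      qed
    qed
    then show False by simp
  qed
  have arcs: "(u, v) \<in> parcs G \<longleftrightarrow>
        (u = c \<and> v \<in> nbrs G c) \<or> (v = c \<and> u \<in> nbrs G c) \<or>
        (u \<in> X \<and> v = m u) \<or> (v \<in> X \<and> u = m v)" (is "?L \<longleftrightarrow> ?R") for u v
  proof
    assume ?R
    then show ?L using XD(5) F(4) by blast
  next
    assume uv: ?L
    \<comment> \<open>Every vertex is the centre, an outer vertex or a neighbour of the centre. Of
      the possible adjacencies only those of the spider survive.\<close>
    have cases: "w = c \<or> w \<in> X \<or> (c, w) \<in> parcs G" if "w \<in> pverts G" for w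
      using that by (auto simp: X_conv)
    from cases[OF F(6)[OF uv]] consider "u = c" | "u \<in> X" | "(c, u) \<in> parcs G" by blast
    then show ?R
    proof cases
      case 1
      then show ?thesis using uv by simp
    next
      case 2
      then have "v \<noteq> c" "v \<notin> X" using uv XD(4)[OF 2] no_XX[OF 2] by auto
      then have "(c, v) \<in> parcs G" using cases[OF F(7)[OF uv]] by blast
      then show ?thesis using mate_unique[OF 2 uv] 2 by simp
    next
      case 3
      then have "(c, v) \<notin> parcs G" using indep uv by blast
      then have "v = c \<or> v \<in> X" using cases[OF F(7)[OF uv]] by blast
      then show ?thesis using mate_unique[OF _ F(4)[OF uv] 3] 3 by auto
    qed
  qed
  have "spider G c X m"
    unfolding spider_def Y
  proof (intro conjI allI)
    show "X \<subseteq> pverts G - {c}" by (auto simp: X_def U_def)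
    show "inj_on m X" using inj by (rule inj_on_subset) (auto simp: X_def)
    show "m ` X \<subseteq> nbrs G c" using XD(6) by auto
    show "(u, v) \<in> parcs G \<longleftrightarrow>
        (u = c \<and> v \<in> nbrs G c) \<or> (v = c \<and> u \<in> nbrs G c) \<or>
        (u \<in> X \<and> v = m u) \<or> (v \<in> X \<and> u = m v)" for u v
      by (rule arcs)
  qed fact+
  moreover have "card X + 1 = card M"
    using cardU card.remove[OF finU cU] by (simp add: X_def)
  ultimately show ?thesis using that by blast
qed

section \<open>Invariance of the arc sum under isomorphism\<close>

lemma digraph_iso_degree:
  assumes "pair_graph G" "bij_betw g (pverts G) (pverts H)"
    and arcs: "parcs H = map_prod g g ` parcs G" and u: "u \<in> pverts G"
  shows "degree H (g u) = degree G u"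
proof -
  have inj: "inj_on g (pverts G)" using assms(2) by (simp add: bij_betw_def)
  note F = pair_graph_facts[OF assms(1)]
  have "nbrs H (g u) = g ` nbrs G u"
  proof
    show "g ` nbrs G u \<subseteq> nbrs H (g u)" by (auto simp: arcs)
    show "nbrs H (g u) \<subseteq> g ` nbrs G u"
    proof
      fix w assume "w \<in> nbrs H (g u)"
      then obtain a b where ab: "(a, b) \<in> parcs G" "g u = g a" "w = g b" by (auto simp: arcs)
      then have "a = u" using inj_onD[OF inj, of u a] u F(6) by blast
      then show "w \<in> g ` nbrs G u" using ab by blast
    qed
  qed
  moreover have "inj_on g (nbrs G u)" using inj F(7) by (auto intro: inj_on_subset)
  ultimately show ?thesis by (simp add: degree_conv_card_nbrs card_image)
qed

text \<open>Both graphs have \<open>fst\<close> and \<open>snd\<close> as tail and head, and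
  compatibility with these forces the arc map to act as the vertex map on both components.\<close>

lemma digraph_isoE:
  assumes "digraph_iso (with_proj G) (with_proj H)"
  obtains g where "bij_betw g (pverts G) (pverts H)" "parcs H = map_prod g g ` parcs G"
proof -
  obtain f where f: "pre_digraph.digraph_isomorphism (with_proj G) f"
    and H: "with_proj H = app_iso f (with_proj G)"
    using assms unfolding digraph_iso_def by blast
  have HH: "pverts H = iso_verts f ` pverts G" "parcs H = iso_arcs f ` parcs G"
    "iso_tail f = fst" "iso_head f = snd"
    using arg_cong[OF H, of verts] arg_cong[OF H, of arcs]
      arg_cong[OF H, of tail] arg_cong[OF H, of head] by simp_all
  have "iso_arcs f a = map_prod (iso_verts f) (iso_verts f) a" if "a \<in> parcs G" for a
    using f that HH(3,4) unfolding pre_digraph.digraph_isomorphism_def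
    by (cases a) (auto intro: prod_eqI)
  then have "parcs H = map_prod (iso_verts f) (iso_verts f) ` parcs G"
    unfolding HH(2) by (rule image_cong[OF refl])
  moreover have "bij_betw (iso_verts f) (pverts G) (pverts H)"
    using f HH(1) by (simp add: pre_digraph.digraph_isomorphism_def bij_betw_def)
  ultimately show ?thesis by (rule that[rotated])
qed

lemma digraph_iso_arc_sum:
  assumes G: "pair_graph G" and "digraph_iso (with_proj G) (with_proj H)"
  shows "arc_sum H = arc_sum G"
proof -
  obtain g where g: "bij_betw g (pverts G) (pverts H)" "parcs H = map_prod g g ` parcs G"
    using assms(2) by (rule digraph_isoE)
  note F = pair_graph_facts[OF G]
  have "parcs G \<subseteq> pverts G \<times> pverts G" using F(6,7) by auto
  then have inj: "inj_on (map_prod g g) (parcs G)"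
    using g(1) inj_on_subset[OF map_prod_inj_on] by (auto simp: bij_betw_def)
  show ?thesis
    unfolding arc_sum_def g(2) using digraph_iso_degree[OF G g] F(6,7)
    by (subst sum.reindex[OF inj]) (auto intro!: sum.cong)
qed

section \<open>Subdivided stars as spiders\<close>

lemma spider_star: "m \<ge> 1 \<Longrightarrow> spider (star m) 0 {} f"
  by (auto simp: spider_def star_def)

text \<open>Subdividing the edge from 0 to \<open>Suc k\<close> turns the leaf \<open>Suc k\<close>
  into an outer vertex with middle vertex \<open>m + k\<close>. Hence the middle vertex of
  \<open>i\<close> is \<open>m + i - 1\<close>.\<close>

lemma spider_subdivided_star:
  assumes "k < m"
  shows "spider (subdivided_star m k) 0 {1..k} (\<lambda>i. m + i - 1) \<and>
    pverts (subdivided_star m k) = {..<m + k}"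
  using assms
proof (induction k)
  case 0
  then show ?case using spider_star[of m] by (simp add: star_def)
next
  case (Suc k)
  then have IH: "spider (subdivided_star m k) 0 {1..k} (\<lambda>i. m + i - 1)"
    and V: "pverts (subdivided_star m k) = {..<m + k}" by auto
  note S = spiderD(9)[OF IH, unfolded V]
  have V': "pverts (subdivided_star m (Suc k)) = {..<m + Suc k}"
    by (simp add: V lessThan_Suc)
  have arcs: "(u, v) \<in> parcs (subdivided_star m (Suc k)) \<longleftrightarrow>
       (u = 0 \<and> v \<in> {..<m + Suc k} - insert 0 {1..Suc k}) \<or>
       (v = 0 \<and> u \<in> {..<m + Suc k} - insert 0 {1..Suc k}) \<or>
       (u \<in> {1..Suc k} \<and> v = m + u - 1) \<or> (v \<in> {1..Suc k} \<and> u = m + v - 1)" for u v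
    using Suc.prems
    by (cases "u = 0"; cases "v = 0"; cases "u = Suc k"; cases "v = Suc k") (auto simp: S)
  have "spider (subdivided_star m (Suc k)) 0 {1..Suc k} (\<lambda>i. m + i - 1)"
    unfolding spider_def V'
  proof (intro conjI allI)
    show "inj_on (\<lambda>i. m + i - 1) {1..Suc k}" by (auto simp: inj_on_def)
    show "(\<lambda>i. m + i - 1) ` {1..Suc k} \<subseteq> {..<m + Suc k} - insert 0 {1..Suc k}"
    proof (rule image_subsetI)
      fix i assume "i \<in> {1..Suc k}"
      then have "1 \<le> i" "i \<le> Suc k" by simp_all
      then obtain j where "i = Suc j" "j \<le> k" by (cases i) auto
      with Suc.prems show "m + i - 1 \<in> {..<m + Suc k} - insert 0 {1..Suc k}" by simp
    qed
    show "(u, v) \<in> parcs (subdivided_star m (Suc k)) \<longleftrightarrow>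
       (u = 0 \<and> v \<in> {..<m + Suc k} - insert 0 {1..Suc k}) \<or>
       (v = 0 \<and> u \<in> {..<m + Suc k} - insert 0 {1..Suc k}) \<or>
       (u \<in> {1..Suc k} \<and> v = m + u - 1) \<or> (v \<in> {1..Suc k} \<and> u = m + v - 1)" for u v
      by (rule arcs)
    show "{1..Suc k} \<subseteq> {..<m + Suc k} - {0}" using Suc.prems by auto
  qed simp_all
  then show ?case using V' by blast
qed

section \<open>Maximum matchings and the bound for trees\<close>

lemma two_card_matching_le:
  assumes G: "pair_graph G" and M: "matching G M"
  shows "2 * card M \<le> card (pverts G)"
proof -
  note F = pair_graph_facts[OF G]
  have e: "card e = 2 \<and> e \<subseteq> pverts G" if "e \<in> M" for e
  proof -
    obtain u v where "e = {u, v}" "(u, v) \<in> parcs G"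
      using \<open>e \<in> M\<close> M by (auto simp: matching_def edges_def)
    then show ?thesis using F(5-7)[of u v] by simp
  qed
  have "card (\<Union>M) = sum card M"
    using M e by (intro card_Union_disjoint) (auto simp: matching_def pairwise_def disjnt_def
        intro: card_ge_0_finite)
  also have "\<dots> = 2 * card M" using e by simp
  finally show ?thesis using card_mono[OF F(1), of "\<Union>M"] e by auto
qed

text \<open>The maximum is taken over a finite set, matchings being sets of edges, and the empty
  matching makes it nonempty.\<close>

lemma matching_number_attained:
  assumes G: "pair_graph G"
  obtains M where "matching G M" "card M = matching_number G"
proof -
  have "finite (edges G)" using G by (rule finite_edges)
  moreover have "{M. matching G M} \<subseteq> Pow (edges G)" by (auto simp: matching_def)
  ultimately have "finite {M. matching G M}" by (meson finite_Pow_iff finite_subset)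
  then have "finite {card M | M. matching G M}" by simp
  moreover have "matching G {}" by (simp add: matching_def)
  ultimately have "matching_number G \<in> {card M | M. matching G M}"
    unfolding matching_number_def by (intro Max_in) auto
  then show ?thesis using that by auto
qed

theorem theorem4p4:
  fixes T :: "'a pair_pre_digraph" and n \<beta> :: nat
  assumes "undirected_tree T"
    and "card (pverts T) = n"
    and "matching_number T = \<beta>"
  shows "SO1 T \<le> 1 / 2 * (real n - real \<beta> - 1) * (real n - real \<beta>) * (real n - real \<beta> + 1)
    \<and> (\<beta> \<ge> 1 \<longrightarrow>
        (SO1 T = 1 / 2 * (real n - real \<beta> - 1) * (real n - real \<beta>) * (real n - real \<beta> + 1)
          \<longleftrightarrow> digraph_iso (with_proj T) (with_proj (M_tree n \<beta>))))"
proof -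
  have forest: "undirected_forest T" using assms(1) by (rule undirected_tree_imp_forest)
  then have T: "pair_graph T" by (simp add: undirected_forest_def)
  obtain M where M: "matching T M" "card M = \<beta>"
    using matching_number_attained[OF T] assms(3) by metis
  define D where "D = n - \<beta>"
  have le: "2 * \<beta> \<le> n" using two_card_matching_le[OF T M(1)] M(2) assms(2) by simp
  then have n: "card (pverts T) = card M + D" using M(2) assms(2) by (simp add: D_def)
  have D: "real n - real \<beta> = real D" using le by (simp add: D_def)
  let ?f = "(real D - 1) * real D * (real D + 1)"
  have main: "arc_sum T \<le> 2 * ?f"
    "M \<noteq> {} \<Longrightarrow> arc_sum T = 2 * ?f \<Longrightarrow> \<exists>v\<in>pverts T. degree T v = D"
    using arc_sum_forest_le[OF forest M(1) n] by blast+
  have SO1: "SO1 T = arc_sum T / 4" using T by (rule SO1_conv_arc_sum)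
  \<comment> \<open>From \<open>\<beta> \<ge> 1\<close> it follows that \<open>M\<close> is nonempty
    and that \<open>\<beta> - 1\<close> is a true predecessor.\<close>
  have "arc_sum T = 2 * ?f \<longleftrightarrow> digraph_iso (with_proj T) (with_proj (M_tree n \<beta>))" if \<beta>: "\<beta> \<ge> 1"
  proof -
    define mate where "mate = (\<lambda>i. D + 1 + i - 1)"
    have Mt: "spider (M_tree n \<beta>) 0 {1..\<beta> - 1} mate" "pverts (M_tree n \<beta>) = {..<n}"
      using spider_subdivided_star[of "\<beta> - 1" "D + 1"] \<beta> le
      by (auto simp: M_tree_def mate_def D_def)
    show ?thesis
    proof
      assume "arc_sum T = 2 * ?f"
      moreover have "M \<noteq> {}" using M(2) \<beta> by auto
      ultimately obtain c where c: "c \<in> pverts T" "degree T c = D" using main(2) by blast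
      obtain X m where X: "spider T c X m" "card X + 1 = card M"
        using spider_if_degree_max[OF forest M(1) c(1)] n c(2) by metis
      show "digraph_iso (with_proj T) (with_proj (M_tree n \<beta>))"
        using X M(2) assms(2) Mt(2) by (intro spider_iso[OF X(1) Mt(1)]) auto
    next
      assume "digraph_iso (with_proj T) (with_proj (M_tree n \<beta>))"
      then have "arc_sum T = arc_sum (M_tree n \<beta>)" by (rule digraph_iso_arc_sum[OF T, symmetric])
      also have "\<dots> = 2 * ?f"
      proof (rule arc_sum_spider[OF Mt(1)])
        have "{..<n} - insert 0 {1..\<beta> - 1} = {\<beta>..<n}" using \<beta> by auto
        then show "degree (M_tree n \<beta>) 0 = D"
          using spider_nbrs(1)[OF Mt(1)] Mt(2) by (simp add: degree_conv_card_nbrs D_def)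
        \<comment> \<open>This is where 2 \<open>\<beta>\<close> \<le> \<open>n\<close> enters:
          \<beta> - 1 < \<beta> \<le> n - \<beta>.\<close>
        show "card {1..\<beta> - 1} < D" using le \<beta> by (simp add: D_def)
      qed
      finally show "arc_sum T = 2 * ?f" .
    qed
  qed
  moreover have "1 / 2 * (real n - real \<beta> - 1) * (real n - real \<beta>) * (real n - real \<beta> + 1) = 2 * ?f / 4"
    by (simp add: D)
  ultimately show ?thesis
    unfolding SO1 using main(1) by (simp only: divide_right_mono divide_cancel_right) simp
qed

end
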